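(* Suppose $\mathfrak g$ is of type $A$ and $\boldsymbol\pi\in\mathcal P^+$ is such that the $q$-factorization graph $G=G(\boldsymbol\pi)$ is totally ordered. If every vertex of $G$ has its color in $\partial I$ (the set of end nodes of the Dynkin diagram), then $G$ is a line whose vertices are alternately colored (i.e., adjacent vertices have different colors).
   Context: Setting. $\mathbb F$ is an algebraically closed field of characteristic $0$ and $q\in\mathbb F^\times$ is not a root of unity. $\mathfrak g$ is of type $A_n$, $I=\{1,\dots,n\}$ is the set of nodes of its Dynkin diagram, and $\partial I=\{1,n\}$. $U_q(\tilde{\mathfrak g})$ is the Drinfeld–Jimbo quantum group over $\mathbb F$ of the loop algebra $\mathfrak g\otimes\mathbb C[t,t^{-1}]$. $\mathcal P^+$ is the multiplicative monoid of $I$-tuples $\boldsymbol\pi=(\boldsymbol\pi_i(u))_{i\in I}$ of polynomials over $\mathbb F$ with constant term $1$ (Drinfeld polynomials), and $L_q(\boldsymbol\pi)$ is the simple finite-dimensional $U_q(\tilde{\mathfrak g})$-module with Drinfeld polynomial $\boldsymbol\pi$. $q$-factorization. For $i\in I,a\in\mathbb F^\times,r\in\mathbb Z_{>0}$, $\boldsymbol\omega_{i,a,r}\in\mathcal P^+$ has $i$-th entry $\prod_{p=0}^{r-1}(1-aq^{r-1-2p}u)$ and all other entries $1$ (KR type polynomial). Every $\boldsymbol\pi\in\mathcal P^+$ is uniquely a product of KR type polynomials such that any two factors $\boldsymbol\omega_{i,a,r},\boldsymbol\omega_{i,b,s}$ with the same $i$ satisfy $a/b\neq q^{\pm(r+s-2p)}$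 for all $0\le p<\min\{r,s\}$; these factors (a multiset) are the $q$-factors of $\boldsymbol\pi$. Reducibility sets. For $i,j\in I$, $r,s\in\mathbb Z_{>0}$, $\mathscr R_{i,j}^{r,s}\subset\mathbb Z_{>0}$ is the finite set such that $L_q(\boldsymbol\omega_{i,a,r})\otimes L_q(\boldsymbol\omega_{j,b,s})$ is reducible iff $a/b=q^m$ with $|m|\in\mathscr R_{i,j}^{r,s}$. In type $A_n$ it is known that $\mathscr R_{i,j}^{r,s}=\{r+s+|i-j|-2p:\ -\min\{\min(i,j)-1,\,n-\max(i,j)\}\le p<\min\{r,s\}\}$. $q$-factorization graph. $G(\boldsymbol\pi)$ is the directed graph whose vertices are the $q$-factors of $\boldsymbol\pi$ (with multiplicities), with an arrow from $\boldsymbol\omega_{i,a,r}$ to $\boldsymbol\omega_{j,b,s}$ iff $a=bq^m$ for some $m\in\mathscr R_{i,j}^{r,s}$. The color of the vertex $\boldsymbol\omega_{i,a,r}$ is $i$. The graph has no oriented cycles; $\preceq$ is the partial order on vertices generated by declaring head $\prec$ tail for each arrow, and $G$ is totally ordered if $\preceq$ is a total order. A line is a connected graph without (undirected) cycles in which every vertex is adjacent to at most two others. *)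

theory Defs
  imports
    "HOL-Library.Multiset"
    "HOL-Computational_Algebra.Polynomial"
    "Graph_Theory.Digraph_Component"
begin

text \<open>
  Throughout, the Dynkin diagram of type \<open>A\<^sub>n\<close> has node set \<open>I = {1..n}\<close>. An \<open>I\<close>-tuple of polynomials
  is a function on \<^typ>\<open>nat\<close> that is constantly \<open>1\<close> outside \<open>I\<close>, so that distinct functions are
  distinct tuples.
\<close>

definition drinfeld_polys :: "nat \<Rightarrow> (nat \<Rightarrow> 'a::field poly) set" where
  "drinfeld_polys n =
     {\<pi>. (\<forall>i\<in>{1..n}. coeff (\<pi> i) 0 = 1) \<and> (\<forall>i. i \<notin> {1..n} \<longrightarrow> \<pi> i = 1)}"

text \<open>
  The triple \<open>(i, a, r)\<close> stands for the polynomial \<open>\<omega>\<^bsub>i,a,r\<^esub>\<close>. If \<open>q \<noteq> 0\<close> is not a root of unity,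
  then \<open>\<omega>\<^bsub>i,a,r\<^esub>\<close> with \<open>a \<noteq> 0\<close> and \<open>r > 0\<close> determines the triple, so nothing is lost by working with
  triples in place of polynomials.
\<close>

type_synonym 'a kr = "nat \<times> 'a \<times> nat"

definition kr_params :: "nat \<Rightarrow> 'a::field kr set" where
  "kr_params n = {(i, a, r). i \<in> {1..n} \<and> a \<noteq> 0 \<and> r > 0}"

fun kr_poly :: "'a::field \<Rightarrow> 'a kr \<Rightarrow> nat \<Rightarrow> 'a poly" where
  "kr_poly q (i, a, r) j =
     (if j = i then \<Prod>p<r. [:1, - (a * q powi (int r - 1 - 2 * int p)):] else 1)"

fun general_position :: "'a::field \<Rightarrow> 'a kr \<Rightarrow> 'a kr \<Rightarrow> bool" where
  "general_position q (i, a, r) (j, b, s) \<longleftrightarrow>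
     (i = j \<longrightarrow> (\<forall>p < min r s.
        a / b \<noteq> q powi (int r + int s - 2 * int p) \<and>
        a / b \<noteq> q powi (- (int r + int s - 2 * int p))))"

text \<open>
  Quantifying over elements of the multiset rather than over pairs of positions makes no difference:
  for \<open>q\<close> not a root of unity, every factor with \<open>a \<noteq> 0\<close> is in general position with itself.
\<close>

definition is_q_factorization ::
  "'a::field \<Rightarrow> nat \<Rightarrow> (nat \<Rightarrow> 'a poly) \<Rightarrow> 'a kr multiset \<Rightarrow> bool" where
  "is_q_factorization q n \<pi> M \<longleftrightarrow>
     set_mset M \<subseteq> kr_params n \<and>
     \<pi> = (\<lambda>j. \<Prod>x\<in>#M. kr_poly q x j) \<and>
     (\<forall>x\<in>#M. \<forall>y\<in>#M. general_position q x y)"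

definition q_factors :: "'a::field \<Rightarrow> nat \<Rightarrow> (nat \<Rightarrow> 'a poly) \<Rightarrow> 'a kr multiset" where
  "q_factors q n \<pi> = (THE M. is_q_factorization q n \<pi> M)"

text \<open>
  The set \<open>\<R>\<^bsub>i,j\<^esub>\<^bsup>r,s\<^esup>\<close> of type \<open>A\<^sub>n\<close>, given by its known closed form: for \<open>i, j \<in> I\<close> and \<open>r, s > 0\<close>, the
  tensor product of the simple modules attached to \<open>(i, a, r)\<close> and \<open>(j, b, s)\<close> is reducible iff
  \<open>a / b = q\<^sup>m\<close> with \<open>\<bar>m\<bar>\<close> in this set. The index \<open>p\<close> may be negative.
\<close>

definition reducibility_set :: "nat \<Rightarrow> nat \<Rightarrow> nat \<Rightarrow> nat \<Rightarrow> nat \<Rightarrow> int set" where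
  "reducibility_set n i j r s =
     {int r + int s + \<bar>int i - int j\<bar> - 2 * p | p :: int.
        - min (int (min i j) - 1) (int n - int (max i j)) \<le> p \<and> p < int (min r s)}"

fun kr_arrow :: "'a::field \<Rightarrow> nat \<Rightarrow> 'a kr \<Rightarrow> 'a kr \<Rightarrow> bool" where
  "kr_arrow q n (i, a, r) (j, b, s) \<longleftrightarrow>
     (\<exists>m \<in> reducibility_set n i j r s. a = b * q powi m)"

text \<open>
  A vertex is a \<open>q\<close>-factor together with a number that tells apart its copies in the multiset.
\<close>

definition qf_graph ::
  "'a::field \<Rightarrow> nat \<Rightarrow> (nat \<Rightarrow> 'a poly) \<Rightarrow> ('a kr \<times> nat) pair_pre_digraph" where
  "qf_graph q n \<pi> =
     (let V = {(x, k). k < count (q_factors q n \<pi>) x}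
      in \<lparr> pverts = V,
           parcs = {(u, v). u \<in> V \<and> v \<in> V \<and> kr_arrow q n (fst u) (fst v)} \<rparr>)"

definition color :: "'a kr \<times> nat \<Rightarrow> nat" where
  "color v = fst (fst v)"

definition vertex_order :: "('v, 'e) pre_digraph \<Rightarrow> 'v rel" where
  "vertex_order G = {(v, u). u \<rightarrow>\<^sup>*\<^bsub>G\<^esub> v}"

definition totally_ordered :: "('v, 'e) pre_digraph \<Rightarrow> bool" where
  "totally_ordered G \<longleftrightarrow> linear_order_on (verts G) (vertex_order G)"

definition adjacent :: "('v, 'e) pre_digraph \<Rightarrow> 'v \<Rightarrow> 'v \<Rightarrow> bool" where
  "adjacent G u v \<longleftrightarrow> u \<rightarrow>\<^bsub>G\<^esub> v \<or> v \<rightarrow>\<^bsub>G\<^esub> u"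

text \<open>
  Two conventions: the empty graph, which is the graph of \<open>\<pi> = 1\<close>, counts as connected although
  \<^const>\<open>connected\<close> excludes it; and traversing an edge back and forth, which is a cycle of length 2 in
  the symmetric digraph \<^const>\<open>mk_symmetric\<close>, is not an undirected cycle.
\<close>

definition undirected_cycle :: "('v, 'e) pre_digraph \<Rightarrow> ('v \<times> 'v) awalk \<Rightarrow> bool" where
  "undirected_cycle G p \<longleftrightarrow>
     pre_digraph.cycle (with_proj (mk_symmetric G)) p \<and> length p \<noteq> 2"

definition line :: "('v, 'e) pre_digraph \<Rightarrow> bool" where
  "line G \<longleftrightarrow>
     (verts G = {} \<or> connected G) \<and>
     (\<nexists>p. undirected_cycle G p) \<and>
     (\<forall>v \<in> verts G. let N = {u \<in> verts G. u \<noteq> v \<and> adjacent G u v} in finite N \<and> card N \<le> 2)"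

end

theory Submission
  imports Defs
begin

text \<open>
  At end nodes the set \<open>\<R>\<^bsub>i,i\<^esub>\<^bsup>r,s\<^esup>\<close> is exactly what general position of \<open>q\<close>-factors forbids, so arrows
  join vertices of different colors, and there are at most two colors. Suppose \<open>x \<rightarrow> y\<close> and there is a
  longer path \<open>x \<rightarrow>\<^sup>+ z \<rightarrow> y\<close>. Then \<open>x\<close> and \<open>z\<close> have the same color, and both ends of their strings of
  exponents decrease along the path, so general position forces the strings to be far apart; hence
  \<open>x\<close> is too far from \<open>y\<close> for an arrow. Without such shortcuts every vertex of a totally ordered graph
  has at most one arrow in and one arrow out, and a walk that never backtracks follows the arrows, so
  there is no cycle.

  For \<^const>\<open>q_factors\<close> to be meaningful, the \<open>q\<close>-factorization must exist and be unique: a longest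
  string contained in the reciprocal roots is a member of every family in general position with these
  roots, and conversely it is in general position with every string contained in them.
\<close>

section \<open>Totally ordered digraphs without shortcuts\<close>

text \<open>An edge traversed against its arrow at \<open>u\<close> would lead to the unique
  predecessor of \<open>u\<close>, which is \<open>w\<close>, where the walk came from. Distinctness
  of the vertices carries this condition on to the next vertex.\<close>

lemma walk_without_backtracking_is_directed:
  assumes in_unique: "\<And>x y z. (x, z) \<in> R \<Longrightarrow> (y, z) \<in> R \<Longrightarrow> x = y"
    and "set p \<subseteq> R \<union> R\<inverse>" "pcas u p v" "p \<noteq> []" "distinct (pawalk_verts u p)"
    and "(w, u) \<in> R" "snd (hd p) \<noteq> w"
  shows "(u, v) \<in> R\<^sup>+"
  using assms(2-)
proof (induction p arbitrary: u w)
  case (Cons e p)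
  obtain x where e: "e = (u, x)"
    using Cons.prems by (cases e) auto
  have ux: "(u, x) \<in> R"
    using Cons.prems in_unique[of w u x] by (auto simp: e)
  show ?case
  proof (cases p)
    case Nil
    then show ?thesis using Cons.prems ux by (auto simp: e)
  next
    case (Cons f p')
    have "snd f \<noteq> u"
      using Cons.prems Cons by (cases p') (auto simp: e)
    then have "(x, v) \<in> R\<^sup>+"
      using Cons.prems Cons ux by (intro Cons.IH[of x u]) (auto simp: e)
    then show ?thesis using ux by auto
  qed
qed simp

text \<open>Without its first edge, a longer cycle is a walk that does not backtrack. It is directed
  in the same sense as that edge, so the edge closes it to a directed cycle.\<close>

lemma no_cycle_if_in_out_unique:
  assumes in_unique: "\<And>x y z. (x, z) \<in> R \<Longrightarrow> (y, z) \<in> R \<Longrightarrow> x = y"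
    and out_unique: "\<And>x y z. (z, x) \<in> R \<Longrightarrow> (z, y) \<in> R \<Longrightarrow> x = y"
    and acyclic: "\<And>x. (x, x) \<notin> R\<^sup>+"
    and "set p \<subseteq> R \<union> R\<inverse>" "pcas u p u" "p \<noteq> []" "distinct (tl (pawalk_verts u p))"
  shows "length p = 2"
proof (rule ccontr)
  assume len: "length p \<noteq> 2"
  obtain x p1 where p: "p = (u, x) # p1"
    using assms(5,6) by (cases p) auto
  have ux: "(u, x) \<in> R \<or> (x, u) \<in> R"
    using assms(4) by (auto simp: p)
  have "p1 \<noteq> []"
    using ux assms(5) acyclic[of u] by (auto simp: p)
  then obtain f p2 where p1: "p1 = f # p2"
    by (cases p1) auto
  have "p2 \<noteq> []"
    using len by (auto simp: p p1)
  then obtain g p3 where p2: "p2 = g # p3"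
    by (cases p2) auto
  have last_vert: "u' \<in> set (pawalk_verts y p')" if "pcas y p' u'" for y u' :: 'a and p'
    using that by (induction p' arbitrary: y) auto
  \<comment> \<open>Since a third edge \<open>g\<close> exists, a return to \<open>u\<close> after
    two edges would list \<open>u\<close> twice after the start: there and at the end of the
    cycle.\<close>
  have "snd f \<noteq> u"
  proof
    assume "snd f = u"
    moreover have "fst g = snd f" "pcas (snd g) p3 u"
      using assms(5) by (auto simp: p p1 p2)
    ultimately show False
      using assms(7) last_vert[of "snd g" p3 u] by (simp add: p p1 p2)
  qed
  then have walk: "set p1 \<subseteq> R \<union> R\<inverse>" "pcas x p1 u" "p1 \<noteq> []" "distinct (pawalk_verts x p1)"
      "snd (hd p1) \<noteq> u"
    using assms(4,5,7) by (auto simp: p p1)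
  show False
    using ux
  proof
    assume R: "(u, x) \<in> R"
    have "(x, u) \<in> R\<^sup>+"
      by (rule walk_without_backtracking_is_directed[OF in_unique walk(1-4) R walk(5)])
    then show False using R acyclic by (meson trancl_into_trancl2)
  next
    assume R: "(x, u) \<in> R"
    \<comment> \<open>The first edge runs against its arrow, so the argument is applied to the
      converse relation, where \<open>out_unique\<close> gives unique predecessors.\<close>
    have "(x, u) \<in> (R\<inverse>)\<^sup>+"
      by (rule walk_without_backtracking_is_directed[where w = u and p = p1])
        (use out_unique walk R in auto)
    then show False using R acyclic by (metis converseD trancl_converse trancl_into_trancl)
  qed
qed

text \<open>Two tails of arrows with a common head are joined by a directed path, which makes one of
  the arrows a shortcut; likewise for two heads. Comparability also gives connectedness.\<close>

lemma line_if_totally_ordered_without_shortcuts: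
  fixes G :: "'v pair_pre_digraph"
  assumes wf: "pair_wf_digraph G"
    and total: "totally_ordered (with_proj G)"
    and loopfree: "\<And>u. (u, u) \<notin> parcs G"
    and no_shortcut: "\<And>u w v. (u, w) \<in> (parcs G)\<^sup>+ \<Longrightarrow> (w, v) \<in> parcs G \<Longrightarrow> (u, v) \<notin> parcs G"
  shows "line (with_proj G)"
proof -
  interpret pair_wf_digraph G by (rule wf)
  let ?R = "parcs G"
  have lin: "linear_order_on (pverts G) (vertex_order (with_proj G))"
    using total by (simp add: totally_ordered_def)
  have comparable: "u \<rightarrow>\<^sup>*\<^bsub>with_proj G\<^esub> v \<or> v \<rightarrow>\<^sup>*\<^bsub>with_proj G\<^esub> u"
    if "u \<in> pverts G" "v \<in> pverts G" for u v
  proof (cases "u = v")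
    case True
    then show ?thesis using that by auto
  next
    case False
    then show ?thesis
      using lin that by (auto simp: linear_order_on_def total_on_def vertex_order_def)
  qed
  have comparable': "(u, v) \<in> ?R\<^sup>+ \<or> (v, u) \<in> ?R\<^sup>+"
    if "u \<in> pverts G" "v \<in> pverts G" "u \<noteq> v" for u v
    using comparable[OF that(1,2)] that(3)
    by (auto simp: reachable_def dest!: rtrancl_on_rtranclI rtranclD)
  \<comment> \<open>By antisymmetry, the first arrow of a directed cycle would be a loop.\<close>
  have acyclic: "(x, x) \<notin> ?R\<^sup>+" for x
  proof
    assume "(x, x) \<in> ?R\<^sup>+"
    then obtain z where z: "(x, z) \<in> ?R" "(z, x) \<in> ?R\<^sup>*"
      by (meson tranclD)
    have "x \<rightarrow>\<^sup>*\<^bsub>with_proj G\<^esub> z" "z \<rightarrow>\<^sup>*\<^bsub>with_proj G\<^esub> x"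
      unfolding reachable_def
      using z by (auto intro!: rtrancl_consistent_rtrancl_on dest: wellformed')
    then have "x = z"
      using lin by (auto simp: linear_order_on_def partial_order_on_def antisym_def vertex_order_def)
    then show False using z loopfree by auto
  qed
  have in_unique: "x = y" if "(x, z) \<in> ?R" "(y, z) \<in> ?R" for x y z
    using that comparable'[of x y] no_shortcut by (metis wellformed'(1))
  have out_unique': False if arcs: "(z, x) \<in> ?R" "(z, y) \<in> ?R" and xy: "(x, y) \<in> ?R\<^sup>+" for x y z
  proof -
    \<comment> \<open>Cutting off the last arrow of the path exhibits \<open>z\<close> to
      \<open>y\<close> as a shortcut of the path through \<open>x\<close> and
      \<open>t\<close>.\<close>
    obtain t where "(x, t) \<in> ?R\<^sup>*" "(t, y) \<in> ?R"
      using xy by (meson tranclD2)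
    then show False
      using arcs no_shortcut[of z t y] by (meson rtrancl_into_trancl2)
  qed
  have out_unique: "x = y" if "(z, x) \<in> ?R" "(z, y) \<in> ?R" for x y z
    using that comparable'[of x y] out_unique' by (metis wellformed'(2))
  have sym_arcs: "parcs (mk_symmetric (with_proj G)) = ?R \<union> ?R\<inverse>"
    by (auto simp: parcs_mk_symmetric)
  have connected: "connected (with_proj G)" if "pverts G \<noteq> {}"
  proof -
    have "u \<rightarrow>\<^sup>*\<^bsub>with_proj (mk_symmetric (with_proj G))\<^esub> v" if "u \<in> pverts G" "v \<in> pverts G" for u v
    proof -
      have "symmetric (with_proj (mk_symmetric (with_proj G)))"
        by (rule symmetric_mk_symmetric)
      then show ?thesis
        using comparable[OF that] reachable_mk_symmetricI symmetric_reachable by metis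
    qed
    then show ?thesis
      using that by (auto simp: connected_def strongly_connected_def)
  qed
  have acyc: "\<not> undirected_cycle (with_proj G) p" for p
  proof
    assume "undirected_cycle (with_proj G) p"
    then obtain u where u: "set p \<subseteq> ?R \<union> ?R\<inverse>" "pcas u p u" "p \<noteq> []"
        "distinct (tl (pawalk_verts u p))" "length p \<noteq> 2"
      by (auto simp: undirected_cycle_def pre_digraph.cycle_def pre_digraph.awalk_def
          cas_with_proj_eq awalk_verts_with_proj_eq sym_arcs)
    have "length p = 2"
      by (rule no_cycle_if_in_out_unique[OF in_unique out_unique acyclic u(1-4)])
    then show False using u(5) by simp
  qed
  have degree: "finite N \<and> card N \<le> 2"
    if N: "N = {u \<in> pverts G. u \<noteq> v \<and> adjacent (with_proj G) u v}" for N v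
  proof -
    \<comment> \<open>\<open>A\<close> and \<open>B\<close> are the only predecessor and successor
      of \<open>v\<close>, or arbitrary if there is none.\<close>
    obtain A where A: "{u. (u, v) \<in> ?R} \<subseteq> {A}"
      using in_unique by (cases "\<exists>u. (u, v) \<in> ?R") auto
    obtain B where B: "{u. (v, u) \<in> ?R} \<subseteq> {B}"
      using out_unique by (cases "\<exists>u. (v, u) \<in> ?R") auto
    have "N \<subseteq> {A, B}"
      using A B by (auto simp: N adjacent_def)
    moreover have "card {A, B} \<le> 2"
      by (simp add: card_insert_if)
    ultimately show ?thesis
      by (meson card_mono finite.emptyI finite.insertI finite_subset le_trans)
  qed
  show ?thesis
    using connected acyc degree by (auto simp: line_def Let_def)
qed

section \<open>Strings of powers of \<open>q\<close>\<close>

text \<open>The reciprocal roots of \<open>kr_poly\<close>, tagged with the color, so that products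
  of tuples become sums of multisets.\<close>

fun kr_roots :: "'a::field \<Rightarrow> 'a kr \<Rightarrow> (nat \<times> 'a) multiset" where
  "kr_roots q (i, a, r) =
     image_mset (\<lambda>p. (i, a * q powi (int r - 1 - 2 * int p))) (mset_set {..<r})"

text \<open>
  Chained strings are those whose union is a string strictly longer than both: the failure of
  general position, with the direction recorded.
\<close>

fun kr_chained :: "'a::field \<Rightarrow> 'a kr \<Rightarrow> 'a kr \<Rightarrow> bool" where
  "kr_chained q (i, a, r) (j, b, s) \<longleftrightarrow>
     i = j \<and> (\<exists>p < min r s. a = b * q powi (int r + int s - 2 * int p))"

declare kr_roots.simps [simp del] kr_chained.simps [simp del]

locale non_root_of_unity =
  fixes q :: "'a::field"
  assumes q_nonzero: "q \<noteq> 0"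
    and q_power_neq_1: "\<And>k. k > 0 \<Longrightarrow> q ^ k \<noteq> 1"
begin

lemma powi_eq_1_iff: "q powi m = 1 \<longleftrightarrow> m = 0"
proof
  assume *: "q powi m = 1"
  show "m = 0"
  proof (rule ccontr)
    assume "m \<noteq> 0"
    then have "q ^ nat \<bar>m\<bar> \<noteq> 1" by (intro q_power_neq_1) auto
    moreover have "q ^ nat \<bar>m\<bar> = 1"
      using * by (cases "m \<ge> 0") (auto simp: power_int_def field_simps q_nonzero)
    ultimately show False by simp
  qed
qed simp

lemma powi_eq_iff: "q powi m = q powi k \<longleftrightarrow> m = k"
proof -
  have "q powi m = q powi (m - k) * q powi k"
    using q_nonzero by (simp flip: power_int_add)
  then show ?thesis
    using powi_eq_1_iff[of "m - k"] q_nonzero by auto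
qed

lemma shift_shift: "a * q powi x * q powi y = a * q powi (x + y)"
  using q_nonzero by (simp add: power_int_add)

lemma shift_inverse: "a = b * q powi m \<longleftrightarrow> b = a * q powi (- m)"
  using q_nonzero by (auto simp: power_int_minus field_simps)

text \<open>Distinct powers of \<open>q\<close> are different, so parameters written relative to a
  common base point \<open>a\<close> reduce to integer exponents.\<close>

lemma in_kr_roots_iff:
  assumes "a \<noteq> 0"
  shows "(j, a * q powi y) \<in># kr_roots q (i, a * q powi x, r) \<longleftrightarrow>
    j = i \<and> \<bar>y - x\<bar> < int r \<and> odd (y - x + int r)"
proof -
  have "(j, a * q powi y) \<in># kr_roots q (i, a * q powi x, r) \<longleftrightarrow>
      j = i \<and> (\<exists>p<r. y = x + (int r - 1 - 2 * int p))"
    using assms by (auto simp: kr_roots.simps shift_shift powi_eq_iff)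
  also have "(\<exists>p<r. y = x + (int r - 1 - 2 * int p)) \<longleftrightarrow> \<bar>y - x\<bar> < int r \<and> odd (y - x + int r)"
    (is "?L \<longleftrightarrow> ?R")
  proof
    assume ?R
    then obtain k where k: "y - x + int r = 2 * k + 1" by (elim conjE oddE)
    \<comment> \<open>The witness solves \<open>y = x + (int r - 1 - 2 * int p)\<close> for
      \<open>p\<close>.\<close>
    show ?L
      using \<open>?R\<close> k by (intro exI[of _ "nat (int r - k - 1)"]) auto
  qed auto
  finally show ?thesis .
qed

lemma in_kr_rootsE:
  assumes "(j, c) \<in># kr_roots q (i, a, r)"
  obtains x where "a = c * q powi x" "i = j"
proof -
  obtain p where "j = i" "c = a * q powi (int r - 1 - 2 * int p)"
    using assms by (auto simp: kr_roots.simps)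
  then show thesis
    using that shift_inverse by blast
qed

text \<open>In terms of exponents: both ends of the first string lie strictly above those of the
  second, the strings overlap or abut, and they have the same parity.\<close>

lemma kr_chained_iff:
  assumes "c \<noteq> 0"
  shows "kr_chained q (i, c * q powi x, r) (j, c * q powi y, s) \<longleftrightarrow>
    i = j \<and> \<bar>int r - int s\<bar> < x - y \<and> x - y \<le> int r + int s \<and> even (x - y + int r + int s)"
proof -
  have "kr_chained q (i, c * q powi x, r) (j, c * q powi y, s) \<longleftrightarrow>
      i = j \<and> (\<exists>p < min r s. x = y + (int r + int s - 2 * int p))"
    using assms by (auto simp: kr_chained.simps shift_shift powi_eq_iff)
  also have "(\<exists>p < min r s. x = y + (int r + int s - 2 * int p)) \<longleftrightarrow>
      \<bar>int r - int s\<bar> < x - y \<and> x - y \<le> int r + int s \<and> even (x - y + int r + int s)"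
    (is "?L \<longleftrightarrow> ?R")
  proof
    assume ?R
    then obtain k where k: "x - y + int r + int s = 2 * k" by (elim conjE evenE)
    show ?L
      using \<open>?R\<close> k by (intro exI[of _ "nat (int r + int s - k)"]) auto
  qed auto
  finally show ?thesis by auto
qed

lemma general_position_iff:
  assumes "x \<in> kr_params n" "y \<in> kr_params n"
  shows "general_position q x y \<longleftrightarrow> \<not> kr_chained q x y \<and> \<not> kr_chained q y x"
proof -
  obtain i a r where x: "x = (i, a, r)" by (cases x)
  obtain j b s where y: "y = (j, b, s)" by (cases y)
  have nz: "a \<noteq> 0" "b \<noteq> 0"
    using assms by (auto simp: x y kr_params_def)
  have *: "a / b = q powi m \<longleftrightarrow> a = b * q powi m" for m
    using nz by (auto simp: field_simps)
  have **: "a / b = q powi (- m) \<longleftrightarrow> b = a * q powi m" for m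
    unfolding * by (subst shift_inverse) simp
  show ?thesis
    unfolding x y general_position.simps kr_chained.simps **
    unfolding * min.commute[of s] add.commute[of "int s"]
    by blast
qed

lemma kr_chained_irrefl:
  assumes "x \<in> kr_params n"
  shows "\<not> kr_chained q x x"
proof -
  obtain i a r where x: "x = (i, a, r)" by (cases x)
  have "a \<noteq> 0" using assms by (auto simp: x kr_params_def)
  then show ?thesis
    using kr_chained_iff[of a i 0 r i 0 r] by (auto simp: x)
qed

lemma inj_on_kr_roots:
  assumes "a \<noteq> 0"
  shows "inj_on (\<lambda>p. (i, a * q powi (int r - 1 - 2 * int p))) {..<r}"
  using assms by (auto simp: inj_on_def powi_eq_iff)

lemma kr_roots_eq_mset_set:
  assumes "x \<in> kr_params n"
  shows "kr_roots q x = mset_set (set_mset (kr_roots q x))"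
proof -
  obtain i a r where x: "x = (i, a, r)" by (cases x)
  have "a \<noteq> 0" using assms by (auto simp: x kr_params_def)
  then show ?thesis
    unfolding x by (simp add: kr_roots.simps image_mset_mset_set[OF inj_on_kr_roots])
qed

lemma size_kr_roots: "size (kr_roots q (i, a, r)) = r"
  by (simp add: kr_roots.simps)

lemma kr_roots_nonempty:
  assumes "x \<in> kr_params n"
  shows "kr_roots q x \<noteq> {#}"
proof -
  obtain i a r where x: "x = (i, a, r)" by (cases x)
  then have "size (kr_roots q x) > 0"
    using assms by (simp add: size_kr_roots kr_params_def)
  then show ?thesis by auto
qed

text \<open>A string has no repeated roots.\<close>

lemma kr_roots_subset_iff:
  assumes "x \<in> kr_params n"
  shows "kr_roots q x \<subseteq># S \<longleftrightarrow> set_mset (kr_roots q x) \<subseteq> set_mset S"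
proof
  assume "set_mset (kr_roots q x) \<subseteq> set_mset S"
  then have "mset_set (set_mset (kr_roots q x)) \<subseteq># mset_set (set_mset S)"
    by (intro subset_imp_msubset_mset_set) auto
  also have "\<dots> \<subseteq># S"
    by (rule mset_set_set_mset_msubset)
  finally show "kr_roots q x \<subseteq># S"
    using kr_roots_eq_mset_set[OF assms] by simp
qed (rule set_mset_mono)

text \<open>The union is a string; the two strings share \<open>p\<close> roots, fewer than either
  has, so it is longer than both.\<close>

lemma kr_chained_union:
  assumes "x \<in> kr_params n" "y \<in> kr_params n" "kr_chained q x y"
  obtains z where "z \<in> kr_params n" "set_mset (kr_roots q z) \<subseteq> set_mset (kr_roots q x) \<union> set_mset (kr_roots q y)"
    "snd (snd z) > snd (snd x)" "snd (snd z) > snd (snd y)"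
proof -
  obtain i a r where x: "x = (i, a, r)" by (cases x)
  obtain j b s where y: "y = (j, b, s)" by (cases y)
  have nz: "a \<noteq> 0" "b \<noteq> 0" and i: "i \<in> {1..n}"
    using assms by (auto simp: x y kr_params_def)
  from assms(3) obtain p where p: "p < min r s" "a = b * q powi (int r + int s - 2 * int p)" and ij: "i = j"
    by (auto simp: x y kr_chained.simps)
  \<comment> \<open>Relative to \<open>b\<close>, the union runs from \<open>1 - s\<close> to
    \<open>2 * r + s - 2 * p - 1\<close>; this gives its center and length.\<close>
  define z where "z = (i, b * q powi (int r - int p), r + s - p)"
  show thesis
  proof (rule that)
    show "z \<in> kr_params n"
      using nz i p q_nonzero by (auto simp: z_def kr_params_def)
    show "set_mset (kr_roots q z) \<subseteq> set_mset (kr_roots q x) \<union> set_mset (kr_roots q y)"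
    proof
      fix c assume c: "c \<in># kr_roots q z"
      obtain k d where kd: "c = (k, d)" by (cases c)
      from c obtain e where "b * q powi (int r - int p) = d * q powi e" "i = k"
        unfolding kd z_def by (elim in_kr_rootsE)
      then have c_eq: "c = (i, b * q powi (int r - int p - e))"
        unfolding kd by (subst (asm) shift_inverse) (simp add: shift_shift)
      define f where "f = int r - int p - e"
      have "\<bar>f - (int r - int p)\<bar> < int (r + s - p)" "odd (f - (int r - int p) + int (r + s - p))"
        using c unfolding c_eq z_def f_def[symmetric] in_kr_roots_iff[OF nz(2)] by auto
      moreover have "int (r + s - p) = int r + int s - int p"
        using p(1) by simp
      ultimately have f: "- int s < f" "f < 2 * int r + int s - 2 * int p" "odd (f + int s)"
        by auto
      then have "odd (f - (int r + int s - 2 * int p) + int r)"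
        by simp
      moreover have "\<bar>f - (int r + int s - 2 * int p)\<bar> < int r \<or> \<bar>f - 0\<bar> < int s"
      proof -
        \<comment> \<open>If the strings merely abut (\<open>p = 0\<close>), the exponent
          \<open>int s\<close> satisfies neither inequality; parity excludes it.\<close>
        have "f \<noteq> int s"
          using f(3) by auto
        then show ?thesis
          using f(1,2) by arith
      qed
      ultimately have "(\<bar>f - (int r + int s - 2 * int p)\<bar> < int r \<and> odd (f - (int r + int s - 2 * int p) + int r))
          \<or> (\<bar>f - 0\<bar> < int s \<and> odd (f - 0 + int s))"
        using f(3) by (simp only: diff_zero) blast
      then show "c \<in> set_mset (kr_roots q x) \<union> set_mset (kr_roots q y)"
        using in_kr_roots_iff[OF nz(2), of i f i "int r + int s - 2 * int p" r]
          in_kr_roots_iff[OF nz(2), of i f i 0 s]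
        unfolding c_eq x y f_def[symmetric] ij p(2) by auto
    qed
  qed (use p in \<open>auto simp: x y z_def\<close>)
qed

section \<open>Decomposing a multiset of roots into unchained strings: existence and
  uniqueness\<close>

definition general_family :: "nat \<Rightarrow> 'a kr multiset \<Rightarrow> bool" where
  "general_family n M \<longleftrightarrow> set_mset M \<subseteq> kr_params n \<and> (\<forall>x\<in>#M. \<forall>y\<in>#M. \<not> kr_chained q x y)"

definition longest_in :: "nat \<Rightarrow> (nat \<times> 'a) multiset \<Rightarrow> 'a kr \<Rightarrow> bool" where
  "longest_in n S x \<longleftrightarrow> x \<in> kr_params n \<and> kr_roots q x \<subseteq># S \<and>
     (\<forall>y\<in>kr_params n. kr_roots q y \<subseteq># S \<longrightarrow> snd (snd y) \<le> snd (snd x))"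

text \<open>A single root is a string of length 1, and the size of \<open>S\<close> bounds all
  lengths.\<close>

lemma longest_in_exists:
  assumes "S \<noteq> {#}" "\<And>i c. (i, c) \<in># S \<Longrightarrow> i \<in> {1..n} \<and> c \<noteq> 0"
  obtains x where "longest_in n S x"
proof -
  obtain i c where ic: "(i, c) \<in># S"
    using assms(1) by (metis multiset_nonemptyE surj_pair)
  let ?P = "\<lambda>x. x \<in> kr_params n \<and> kr_roots q x \<subseteq># S"
  have "?P (i, c, 1)"
    using assms(2)[OF ic] ic by (auto simp: kr_params_def kr_roots.simps lessThan_Suc)
  moreover have "\<forall>y. ?P y \<longrightarrow> snd (snd y) < Suc (size S)"
  proof (intro allI impI)
    fix y assume y: "?P y"
    then show "snd (snd y) < Suc (size S)"
      by (cases y) (metis less_Suc_eq_le size_kr_roots size_mset_mono snd_conv)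
  qed
  ultimately obtain x where "?P x" "\<forall>y. ?P y \<longrightarrow> snd (snd y) \<le> snd (snd x)"
    using ex_has_greatest_nat[of ?P "(i, c, 1)" "\<lambda>y. snd (snd y)"] by blast
  then show thesis
    using that unfolding longest_in_def by blast
qed

text \<open>
  If a member of \<open>M\<close> covers a proper prefix of the string of \<open>x\<close> and no more, a member covering the
  next root must contain it, as otherwise the two would be chained. So some member contains the whole
  string, and it equals \<open>x\<close> by maximality.
\<close>

lemma longest_in_mem:
  assumes M: "general_family n M" and x: "longest_in n (\<Sum>y\<in>#M. kr_roots q y) x"
  shows "x \<in># M"
proof -
  obtain i a r where xdef: "x = (i, a, r)" by (cases x)
  have nz: "a \<noteq> 0" and r: "r > 0"
    using x by (auto simp: xdef longest_in_def kr_params_def)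
  let ?e = "\<lambda>p. int r - 1 - 2 * int p"
  have covered: "\<exists>b s. (i, a * q powi b, s) \<in># M \<and> \<bar>?e p - b\<bar> < int s \<and> odd (?e p - b + int s)"
    if "p < r" for p
  proof -
    have "(i, a * q powi ?e p) \<in># kr_roots q x"
      using that by (auto simp: xdef kr_roots.simps)
    then have "(i, a * q powi ?e p) \<in># (\<Sum>y\<in>#M. kr_roots q y)"
      using x mset_subset_eqD unfolding longest_in_def by metis
    then obtain y where y: "y \<in># M" "(i, a * q powi ?e p) \<in># kr_roots q y"
      by auto
    obtain j b s where ydef: "y = (j, b, s)" by (cases y)
    obtain f where "b = a * q powi ?e p * q powi f" and ij: "j = i"
      using y(2) unfolding ydef by (elim in_kr_rootsE)
    then have b: "b = a * q powi (?e p + f)"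
      by (simp add: shift_shift)
    show ?thesis
      using y unfolding ydef ij b in_kr_roots_iff[OF nz] by blast
  qed
  have prefix: "\<exists>b s. (i, a * q powi b, s) \<in># M \<and>
      (\<forall>p\<le>k. \<bar>?e p - b\<bar> < int s \<and> odd (?e p - b + int s))" if "k < r" for k
    using that
  proof (induction k)
    case 0
    then show ?case using covered[of 0] by auto
  next
    case (Suc k)
    then obtain b s where y: "(i, a * q powi b, s) \<in># M"
      "\<And>p. p \<le> k \<Longrightarrow> \<bar>?e p - b\<bar> < int s \<and> odd (?e p - b + int s)" by auto
    obtain b' s' where y': "(i, a * q powi b', s') \<in># M"
      "\<bar>?e (Suc k) - b'\<bar> < int s'" "odd (?e (Suc k) - b' + int s')"
      using covered[OF Suc.prems] by auto
    have not_chained: "\<not> (\<bar>int s - int s'\<bar> < b - b' \<and> b - b' \<le> int s + int s' \<and> even (b - b' + int s + int s'))"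
      using M y(1) y'(1) kr_chained_iff[OF nz, of i b s i b' s'] by (auto simp: general_family_def)
    show ?case
    proof (cases "\<bar>?e (Suc k) - b\<bar> < int s")
      case True
      have "odd (?e (Suc k) - b + int s)"
        using y(2)[of k] by auto
      then show ?thesis
        using y True by (intro exI[of _ b] exI[of _ s]) (auto simp: le_Suc_eq)
    next
      case False
      have k: "\<bar>?e k - b\<bar> < int s" "odd (?e k - b + int s)" "\<bar>?e 0 - b\<bar> < int s"
        using y(2)[of k] y(2)[of 0] by auto
      \<comment> \<open>The exponents \<open>?e\<close> descend in steps of 2, and the string at
        \<open>b\<close> contains \<open>?e k\<close> but not \<open>?e (Suc k)\<close>.\<close>
      have bottom: "?e k = b - int s + 1"
      proof -
        obtain c where c: "?e k - b + int s = 2 * c + 1"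
          using k(2) by (elim oddE)
        then have "c = 0"
          using k(1,3) False by simp
        then show ?thesis using c by simp
      qed
      \<comment> \<open>Otherwise the string at \<open>b\<close> exceeds the one at
        \<open>b'\<close> at both ends without a gap, so the two are chained.\<close>
      have top: "b + int s \<le> b' + int s'"
      proof (rule ccontr)
        assume neg: "\<not> b + int s \<le> b' + int s'"
        have "even (b - b' + int s + int s')"
          using bottom y'(3) by simp presburger
        then show False
          using not_chained neg bottom y'(2) by (auto simp: abs_less_iff)
      qed
      have "\<bar>?e p - b'\<bar> < int s' \<and> odd (?e p - b' + int s')" if "p \<le> Suc k" for p
      proof -
        have "odd (?e p - b' + int s')"
          using y'(3) by auto
        moreover have "?e (Suc k) \<le> ?e p" "?e p \<le> ?e 0"
          using that by auto
        ultimately show ?thesis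
          using top y'(2) k(3) by linarith
      qed
      then show ?thesis using y'(1) by blast
    qed
  qed
  obtain b s where y: "(i, a * q powi b, s) \<in># M"
      "\<And>p. p \<le> r - 1 \<Longrightarrow> \<bar>?e p - b\<bar> < int s \<and> odd (?e p - b + int s)"
    using prefix[of "r - 1"] r by auto
  have "(i, a * q powi b, s) \<in> kr_params n"
    using M y(1) by (auto simp: general_family_def)
  moreover have "kr_roots q (i, a * q powi b, s) \<subseteq># (\<Sum>y\<in>#M. kr_roots q y)"
    using y(1) by (metis image_mset_add_mset multi_member_split mset_subset_eq_add_left sum_mset.add_mset)
  ultimately have "s \<le> r"
    using x by (force simp: longest_in_def xdef)
  moreover have "\<bar>int r - 1 - b\<bar> < int s" "\<bar>1 - int r - b\<bar> < int s"
    using y(2)[of 0] y(2)[of "r - 1"] r by (auto simp: of_nat_diff)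
  \<comment> \<open>A string with at most \<open>r\<close> roots that contains both ends of
    \<open>x\<close> cannot be shifted or shorter.\<close>
  ultimately have "s = r" "b = 0" by linarith+
  then show ?thesis using y(1) by (simp add: xdef)
qed

text \<open>A longest string in the common roots belongs to both families; remove it and
  induct.\<close>

lemma general_family_unique:
  assumes "general_family n M" "general_family n M'"
    and "(\<Sum>x\<in>#M. kr_roots q x) = (\<Sum>x\<in>#M'. kr_roots q x)"
  shows "M = M'"
  using assms
proof (induction "size M" arbitrary: M M')
  case 0
  have "kr_roots q x \<noteq> {#}" if "x \<in># M'" for x
    using that 0 kr_roots_nonempty[of x n] by (auto simp: general_family_def)
  then show ?case using 0 by (cases M') auto
next
  case (Suc k)
  let ?S = "\<Sum>x\<in>#M. kr_roots q x"
  have "kr_roots q x \<noteq> {#}" if "x \<in># M" for x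
    using that Suc kr_roots_nonempty[of x n] by (auto simp: general_family_def)
  then have "?S \<noteq> {#}"
    using Suc.hyps(2) by (cases M) auto
  moreover have "i \<in> {1..n} \<and> c \<noteq> 0" if "(i, c) \<in># ?S" for i c
    using that Suc.prems(1) q_nonzero by (fastforce simp: general_family_def kr_params_def kr_roots.simps)
  ultimately obtain x where x: "longest_in n ?S x"
    using longest_in_exists by blast
  have "x \<in># M" "x \<in># M'"
    using longest_in_mem x Suc.prems by metis+
  then obtain N N' where N: "M = add_mset x N" "M' = add_mset x N'"
    by (meson multi_member_split)
  have "N = N'"
    using Suc.prems Suc.hyps(2)
    by (intro Suc.hyps(1)) (auto simp: N general_family_def)
  then show ?case by (simp add: N)
qed

text \<open>Greedy choice: split off a longest string and recurse. If it were chained with a later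
  string, their union would be a longer string in \<open>S\<close>.\<close>

lemma general_family_exists:
  assumes "\<And>i c. (i, c) \<in># S \<Longrightarrow> i \<in> {1..n} \<and> c \<noteq> 0"
  shows "\<exists>M. general_family n M \<and> (\<Sum>x\<in>#M. kr_roots q x) = S"
  using assms
proof (induction "size S" arbitrary: S rule: less_induct)
  case less
  show ?case
  proof (cases "S = {#}")
    case True
    then show ?thesis by (intro exI[of _ "{#}"]) (auto simp: general_family_def)
  next
    case False
    obtain x where x: "longest_in n S x"
      using longest_in_exists[OF False less.prems] by blast
    obtain T where T: "S = kr_roots q x + T"
      using x by (auto simp: longest_in_def mset_subset_eq_exists_conv)
    have "kr_roots q x \<noteq> {#}"
      using x kr_roots_nonempty[of x n] by (auto simp: longest_in_def)
    then have "size T < size S"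
      by (simp add: T nonempty_has_size)
    then obtain M where M: "general_family n M" "(\<Sum>x\<in>#M. kr_roots q x) = T"
      using less.hyps[of T] less.prems by (auto simp: T)
    have params: "x \<in> kr_params n" "\<And>y. y \<in># M \<Longrightarrow> y \<in> kr_params n"
      using x M by (auto simp: longest_in_def general_family_def)
    have sub: "set_mset (kr_roots q y) \<subseteq> set_mset S" if "y \<in># M" for y
      using that M(2) by (auto simp: T)
    have "\<not> kr_chained q x y \<and> \<not> kr_chained q y x" if y: "y \<in># M" for y
    proof (rule ccontr)
      assume "\<not> ?thesis"
      then obtain z where z: "z \<in> kr_params n" "snd (snd z) > snd (snd x)"
        "set_mset (kr_roots q z) \<subseteq> set_mset (kr_roots q x) \<union> set_mset (kr_roots q y)"
        using kr_chained_union[of x n y] kr_chained_union[of y n x] params y by (metis sup_commute)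
      then have "kr_roots q z \<subseteq># S"
        using kr_roots_subset_iff[OF z(1)] sub[OF y] by (auto simp: T)
      then show False
        using x z by (auto simp: longest_in_def)
    qed
    then have "general_family n (add_mset x M)"
      using M(1) params kr_chained_irrefl by (auto simp: general_family_def)
    then show ?thesis
      using M(2) T by (intro exI[of _ "add_mset x M"]) auto
  qed
qed

end

section \<open>Drinfeld polynomials and their reciprocal roots\<close>

definition poly_of_roots :: "(nat \<times> 'a::field) multiset \<Rightarrow> nat \<Rightarrow> 'a poly" where
  "poly_of_roots S j = (\<Prod>z\<in>#S. if j = fst z then [:1, - snd z:] else 1)"

lemma poly_of_roots_simps [simp]:
  "poly_of_roots {#} j = 1"
  "poly_of_roots (add_mset z S) j = (if j = fst z then [:1, - snd z:] else 1) * poly_of_roots S j"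
  "poly_of_roots (S + T) j = poly_of_roots S j * poly_of_roots T j"
  by (simp_all add: poly_of_roots_def)

lemma poly_of_roots_nonzero: "poly_of_roots S j \<noteq> 0"
  by (induction S) auto

text \<open>A factor \<open>[:1, - d:]\<close> vanishes at \<open>inverse c\<close> only for
  \<open>d = c\<close>, and then to order 1.\<close>

lemma order_poly_of_roots:
  assumes "c \<noteq> 0"
  shows "order (inverse c) (poly_of_roots S j) = count S (j, c)"
proof (induction S)
  case empty
  then show ?case by (simp add: order_1_eq_0)
next
  case (add z S)
  obtain i d where z: "z = (i, d)" by (cases z)
  have "order (inverse c) [:1, - d:] = (if d = c then 1 else 0)"
  proof (cases "d = c")
    case True
    have "[:1, - c:] = smult (- c) [:- inverse c, 1:]"
      using assms by simp
    moreover have "order (inverse c) [:- inverse c, 1:] = 1"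
      using order_power_n_n[of "inverse c" 1] by simp
    ultimately show ?thesis
      using True assms order_smult[of "- c" "inverse c" "[:- inverse c, 1:]"] by simp
  next
    case False
    have "poly [:1, - d:] (inverse c) \<noteq> 0"
      using False assms by (auto simp: field_simps)
    then show ?thesis
      using False by (simp add: order_0I)
  qed
  moreover have "poly_of_roots (add_mset z S) j \<noteq> 0"
    by (rule poly_of_roots_nonzero)
  ultimately show ?case
    using add by (auto simp: z order_mult)
qed

text \<open>An entry with second component 0 contributes the factor 1 and leaves no trace; all
  others are counted by orders of vanishing.\<close>

lemma poly_of_roots_inject:
  assumes "\<And>i c. (i, c) \<in># S \<Longrightarrow> c \<noteq> 0" "\<And>i c. (i, c) \<in># T \<Longrightarrow> c \<noteq> 0"
    and "poly_of_roots S = poly_of_roots T"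
  shows "S = T"
proof (rule multiset_eqI)
  fix z :: "nat \<times> 'a"
  obtain i c where z: "z = (i, c)" by (cases z)
  show "count S z = count T z"
  proof (cases "c = 0")
    case True
    then show ?thesis
      using assms(1,2) unfolding z by (metis not_in_iff)
  next
    case False
    then show ?thesis
      using order_poly_of_roots[of c _ i] assms(3) unfolding z by metis
  qed
qed

lemma poly_of_roots_single_color:
  fixes p :: "'a::alg_closed_field poly"
  assumes "coeff p 0 = 1"
  shows "\<exists>S. (\<forall>z\<in>#S. fst z = i \<and> snd z \<noteq> 0) \<and> poly_of_roots S = (\<lambda>j. if j = i then p else 1)"
  using assms
proof (induction "degree p" arbitrary: p)
  case 0
  then have "p = 1"
    by (metis degree_0_id one_pCons)
  then show ?case
    by (intro exI[of _ "{#}"]) auto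
next
  case (Suc k)
  obtain x where x: "poly p x = 0"
    using alg_closed_imp_poly_has_root[of p] Suc.hyps(2) by auto
  then obtain g where g: "p = [:- x, 1:] * g"
    by (auto simp: poly_eq_0_iff_dvd)
  have x0: "x \<noteq> 0" and cg: "- x * coeff g 0 = 1"
    using Suc.prems by (auto simp: g)
  \<comment> \<open>The scalar moves from \<open>[:- x, 1:]\<close> to the cofactor, so that both
    factors have constant term 1.\<close>
  define h where "h = smult (- x) g"
  have p: "p = [:1, - inverse x:] * h"
  proof -
    have "[:- x, 1:] = smult (- x) [:1, - inverse x:]"
      using x0 by simp
    then show ?thesis
      unfolding g h_def by (metis mult_smult_left mult_smult_right)
  qed
  have "g \<noteq> 0" using cg by auto
  then have "degree p = Suc (degree g)"
    unfolding g by (subst degree_mult_eq) auto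
  then have "k = degree h"
    using Suc.hyps(2) x0 by (simp add: h_def)
  moreover have "coeff h 0 = 1"
    using cg by (simp add: h_def)
  ultimately obtain S where S: "\<forall>z\<in>#S. fst z = i \<and> snd z \<noteq> 0"
      "poly_of_roots S = (\<lambda>j. if j = i then h else 1)"
    using Suc.hyps(1) by blast
  show ?case
    using S x0 p
    by (intro exI[of _ "add_mset (i, inverse x) S"]) (auto simp: fun_eq_iff)
qed

lemma drinfeld_polys_eq_poly_of_roots:
  fixes \<pi> :: "nat \<Rightarrow> 'a::alg_closed_field poly"
  assumes "\<pi> \<in> drinfeld_polys n"
  obtains S where "\<And>i c. (i, c) \<in># S \<Longrightarrow> i \<in> {1..n} \<and> c \<noteq> 0" "poly_of_roots S = \<pi>"
proof -
  have "\<exists>S. (\<forall>z\<in>#S. fst z = i \<and> snd z \<noteq> 0) \<and> poly_of_roots S = (\<lambda>j. if j = i then \<pi> i else 1)"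
    if "i \<in> {1..n}" for i
    using assms that by (intro poly_of_roots_single_color) (auto simp: drinfeld_polys_def)
  then obtain T where T: "\<And>i. i \<in> {1..n} \<Longrightarrow> \<forall>z\<in>#T i. fst z = i \<and> snd z \<noteq> 0"
      "\<And>i. i \<in> {1..n} \<Longrightarrow> poly_of_roots (T i) = (\<lambda>j. if j = i then \<pi> i else 1)"
    by metis
  have sum: "poly_of_roots (\<Sum>i\<in>A. T i) j = (\<Prod>i\<in>A. poly_of_roots (T i) j)" for A j
    by (induction A rule: infinite_finite_induct) auto
  show thesis
  proof (rule that)
    show "i \<in> {1..n} \<and> c \<noteq> 0" if "(i, c) \<in># (\<Sum>i\<in>{1..n}. T i)" for i c
      using that T(1) by (fastforce simp: set_mset_sum)
    show "poly_of_roots (\<Sum>i\<in>{1..n}. T i) = \<pi>"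
    proof
      fix j
      have "poly_of_roots (\<Sum>i\<in>{1..n}. T i) j = (\<Prod>i\<in>{1..n}. if j = i then \<pi> i else 1)"
        unfolding sum by (intro prod.cong refl) (simp add: T(2))
      also have "\<dots> = \<pi> j"
        using assms by (auto simp: drinfeld_polys_def)
      finally show "poly_of_roots (\<Sum>i\<in>{1..n}. T i) j = \<pi> j" .
    qed
  qed
qed

lemma kr_poly_eq_poly_of_roots: "kr_poly q x j = poly_of_roots (kr_roots q x) j"
proof -
  obtain i a r where x: "x = (i, a, r)" by (cases x)
  show ?thesis
    by (simp add: x poly_of_roots_def kr_roots.simps prod_unfold_prod_mset multiset.map_comp comp_def)
qed

lemma prod_kr_poly_eq_poly_of_roots:
  "(\<Prod>x\<in>#M. kr_poly q x j) = poly_of_roots (\<Sum>x\<in>#M. kr_roots q x) j"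
  by (induction M) (simp_all add: kr_poly_eq_poly_of_roots)

section \<open>The \<open>q\<close>-factorization of a tuple of Drinfeld polynomials\<close>

context non_root_of_unity
begin

lemma is_q_factorization_iff:
  "is_q_factorization q n \<pi> M \<longleftrightarrow> general_family n M \<and> \<pi> = poly_of_roots (\<Sum>x\<in>#M. kr_roots q x)"
proof -
  have "(\<forall>x\<in>#M. \<forall>y\<in>#M. general_position q x y) \<longleftrightarrow> (\<forall>x\<in>#M. \<forall>y\<in>#M. \<not> kr_chained q x y)"
    if "set_mset M \<subseteq> kr_params n"
    using that general_position_iff by (meson subsetD)
  then show ?thesis
    by (auto simp only: is_q_factorization_def general_family_def prod_kr_poly_eq_poly_of_roots)
qed

lemma snd_kr_roots_nonzero:
  assumes "general_family n M" "(i, c) \<in># (\<Sum>x\<in>#M. kr_roots q x)"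
  shows "c \<noteq> 0"
  using assms q_nonzero by (fastforce simp: general_family_def kr_params_def kr_roots.simps)

end

text \<open>The definite description in \<open>q_factors\<close> denotes: the tuple determines its
  root multiset, and this determines the family of strings.\<close>

lemma is_q_factorization_q_factors:
  fixes q :: "'a::alg_closed_field"
  assumes "non_root_of_unity q" "\<pi> \<in> drinfeld_polys n"
  shows "is_q_factorization q n \<pi> (q_factors q n \<pi>)"
proof -
  interpret non_root_of_unity q by fact
  obtain S where S: "\<And>i c. (i, c) \<in># S \<Longrightarrow> i \<in> {1..n} \<and> c \<noteq> 0" "poly_of_roots S = \<pi>"
    using drinfeld_polys_eq_poly_of_roots[OF assms(2)] by blast
  then obtain M where "general_family n M" "(\<Sum>x\<in>#M. kr_roots q x) = S"
    using general_family_exists by blast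
  then have "is_q_factorization q n \<pi> M"
    using S by (simp add: is_q_factorization_iff)
  moreover have "M = M'" if "is_q_factorization q n \<pi> M" "is_q_factorization q n \<pi> M'" for M M'
    using that poly_of_roots_inject snd_kr_roots_nonzero general_family_unique
    unfolding is_q_factorization_iff by metis
  ultimately show ?thesis
    unfolding q_factors_def by (metis the_equality)
qed

section \<open>Arrows between end nodes\<close>

lemma reducibility_set_ends:
  assumes "i \<in> {1, n}" "j \<in> {1, n}" "n \<ge> 1"
  shows "m \<in> reducibility_set n i j r s \<longleftrightarrow>
    \<bar>int r - int s\<bar> + \<bar>int i - int j\<bar> < m \<and> m \<le> int r + int s + \<bar>int i - int j\<bar> \<and>
    even (m + int r + int s + int i + int j)"
proof -
  have "i = 1 \<or> i = n" "j = 1 \<or> j = n"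
    using assms by auto
  \<comment> \<open>This is where end nodes matter: the index \<open>p\<close> cannot be
    negative.\<close>
  then have "min (int (min i j) - 1) (int n - int (max i j)) = 0"
    using assms(3) by linarith
  then have "m \<in> reducibility_set n i j r s \<longleftrightarrow>
      (\<exists>p. m = int r + int s + \<bar>int i - int j\<bar> - 2 * p \<and> 0 \<le> p \<and> p < int (min r s))"
    by (simp add: reducibility_set_def)
  also have "\<dots> \<longleftrightarrow> \<bar>int r - int s\<bar> + \<bar>int i - int j\<bar> < m \<and> m \<le> int r + int s + \<bar>int i - int j\<bar> \<and>
    even (m + int r + int s + int i + int j)" (is "?L \<longleftrightarrow> ?R")
  proof
    assume ?R
    then obtain k where k: "m + int r + int s + int i + int j = 2 * k" by (elim conjE evenE)
    show ?L
      \<comment> \<open>The witness for \<open>p\<close> comes from \<open>\<bar>int i - int j\<bar>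
        + int i + int j = 2 * max (int i) (int j)\<close>.\<close>
      using \<open>?R\<close> k
      by (intro exI[of _ "int r + int s - k + max (int i) (int j)"]) auto
  qed auto
  finally show ?thesis .
qed

context non_root_of_unity
begin

lemma kr_arrow_same_color:
  assumes "kr_arrow q n x y" "fst x = fst y" "fst x \<in> {1, n}" "n \<ge> 1" "y \<in> kr_params n"
  shows "kr_chained q x y"
proof -
  obtain i a r where x: "x = (i, a, r)" by (cases x)
  obtain j b s where y: "y = (j, b, s)" by (cases y)
  have b: "b \<noteq> 0" and j: "i = j" "j \<in> {1, n}"
    using assms by (auto simp: x y kr_params_def)
  obtain m where m: "a = b * q powi m" "m \<in> reducibility_set n j j r s"
    using assms by (auto simp: x y)
  show ?thesis
    using m(2) kr_chained_iff[OF b, of j m r j 0 s]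
    unfolding x y m(1) j(1) reducibility_set_ends[OF j(2,2) assms(4)] by auto
qed

text \<open>
  In terms of the intervals of exponents \<open>[m - r + 1, m + r - 1]\<close>, both endpoints decrease along
  every arrow.
\<close>

fun kr_above :: "'a kr \<Rightarrow> 'a kr \<Rightarrow> bool" where
  "kr_above (i, a, r) (j, b, s) \<longleftrightarrow>
     (\<exists>m. a = b * q powi m \<and> \<bar>int r - int s\<bar> < m \<and> even (m + int r + int s + int i + int j))"

text \<open>Exponents add, and the triangle inequality bounds the difference of the lengths.\<close>

lemma kr_above_trans:
  assumes "kr_above x y" "kr_above y z"
  shows "kr_above x z"
proof -
  obtain i a r where x: "x = (i, a, r)" by (cases x)
  obtain j b s where y: "y = (j, b, s)" by (cases y)
  obtain k c t where z: "z = (k, c, t)" by (cases z)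
  obtain m where m: "a = b * q powi m" "\<bar>int r - int s\<bar> < m" "even (m + int r + int s + int i + int j)"
    using assms(1) by (auto simp: x y)
  obtain l where l: "b = c * q powi l" "\<bar>int s - int t\<bar> < l" "even (l + int s + int t + int j + int k)"
    using assms(2) by (auto simp: y z)
  have "a = c * q powi (l + m)"
    using m(1) l(1) by (simp add: shift_shift)
  moreover have "\<bar>int r - int t\<bar> < l + m"
    using m(2) l(2) by linarith
  moreover have "even (l + m + int r + int t + int i + int k)"
    using m(3) l(3) by presburger
  ultimately show ?thesis
    by (auto simp: x z)
qed

lemma kr_arrow_imp_above:
  assumes "kr_arrow q n x y" "fst x \<in> {1, n}" "fst y \<in> {1, n}" "n \<ge> 1"
  shows "kr_above x y"
proof -
  obtain i a r where x: "x = (i, a, r)" by (cases x)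
  obtain j b s where y: "y = (j, b, s)" by (cases y)
  obtain m where m: "a = b * q powi m" "m \<in> reducibility_set n i j r s"
    using assms by (auto simp: x y)
  have ij: "i \<in> {1, n}" "j \<in> {1, n}"
    using assms by (auto simp: x y)
  show ?thesis
    using m(1) m(2)[unfolded reducibility_set_ends[OF ij assms(4)]]
    by (auto simp: x y intro!: exI[of _ m])
qed

text \<open>As \<open>x\<close> and \<open>z\<close> are not chained, their exponents differ by more
  than \<open>r + t\<close>. Adding the lower bound for the arrow from \<open>z\<close> to
  \<open>y\<close> exceeds the largest exponent allowed from \<open>x\<close> to
  \<open>y\<close>.\<close>

lemma no_arrow_shortcut:
  assumes "kr_above x z" "kr_arrow q n z y" "kr_arrow q n x y"
    and "\<not> kr_chained q x z" "fst x = fst z" "fst y \<in> {1, n}" "fst z \<in> {1, n}"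
    and "n \<ge> 1" "y \<in> kr_params n"
  shows False
proof -
  obtain i a r where x: "x = (i, a, r)" by (cases x)
  obtain j b s where y: "y = (j, b, s)" by (cases y)
  obtain c t where z: "z = (i, c, t)" using assms(5) by (cases z) (auto simp: x)
  have b: "b \<noteq> 0" and ij: "i \<in> {1, n}" "j \<in> {1, n}"
    using assms by (auto simp: x y z kr_params_def)
  obtain l where l: "c = b * q powi l" "l \<in> reducibility_set n i j t s"
    using assms(2) by (auto simp: y z)
  obtain m where m: "a = b * q powi m" "m \<in> reducibility_set n i j r s"
    using assms(3) by (auto simp: x y)
  obtain k where k: "a = c * q powi k" "\<bar>int r - int t\<bar> < k" "even (k + int r + int t + int i + int i)"
    using assms(1) by (auto simp: x z)
  have klm: "m = l + k"
    using m(1) k(1) b unfolding l(1) by (simp add: shift_shift powi_eq_iff)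
  \<comment> \<open>\<open>kr_above\<close> already supplies the lower bound and the parity in
    \<open>kr_chained_iff\<close>, so only the upper bound can fail.\<close>
  have "\<not> (k \<le> int r + int t)"
    using assms(4) kr_chained_iff[OF b, of i m r i l t] k(2,3)
    unfolding x z m(1) l(1) by (auto simp: klm)
  moreover have "\<bar>int t - int s\<bar> + \<bar>int i - int j\<bar> < l" "m \<le> int r + int s + \<bar>int i - int j\<bar>"
    using l(2) m(2) unfolding reducibility_set_ends[OF ij assms(8)] by auto
  ultimately show False
    unfolding klm by linarith
qed

end

theorem proposition3p5p6:
  fixes q :: "'a :: {alg_closed_field, field_char_0}"
    and n :: nat
    and \<pi> :: "nat \<Rightarrow> 'a poly"
  assumes "n \<ge> 1"
    and "q \<noteq> 0"
    and "\<And>k. k > 0 \<Longrightarrow> q ^ k \<noteq> 1"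
    and "\<pi> \<in> drinfeld_polys n"
    and "totally_ordered (with_proj (qf_graph q n \<pi>))"
    and "\<And>v. v \<in> pverts (qf_graph q n \<pi>) \<Longrightarrow> color v \<in> {1, n}"
  shows "line (with_proj (qf_graph q n \<pi>)) \<and>
         (\<forall>u v. adjacent (with_proj (qf_graph q n \<pi>)) u v \<longrightarrow> color u \<noteq> color v)"
proof -
  interpret non_root_of_unity q
    using assms(2,3) by unfold_locales
  define G where "G = qf_graph q n \<pi>"
  have "is_q_factorization q n \<pi> (q_factors q n \<pi>)"
    using is_q_factorization_q_factors assms(4) non_root_of_unity_axioms by blast
  then have general: "general_family n (q_factors q n \<pi>)"
    by (simp add: is_q_factorization_iff)
  have vert: "fst v \<in># q_factors q n \<pi>" if "v \<in> pverts G" for v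
    using that by (auto simp: G_def qf_graph_def Let_def simp flip: count_greater_zero_iff)
  have params: "fst v \<in> kr_params n" if "v \<in> pverts G" for v
    using vert[OF that] general by (auto simp: general_family_def)
  have not_chained: "\<not> kr_chained q (fst u) (fst v)" if "u \<in> pverts G" "v \<in> pverts G" for u v
    using vert that general by (auto simp: general_family_def)
  have color: "fst (fst v) \<in> {1, n}" if "v \<in> pverts G" for v
    using assms(6) that by (simp add: G_def color_def)
  have arc: "u \<in> pverts G \<and> v \<in> pverts G \<and> kr_arrow q n (fst u) (fst v)" if "(u, v) \<in> parcs G" for u v
    using that by (auto simp: G_def qf_graph_def Let_def)
  have diff: "fst (fst u) \<noteq> fst (fst v)" if "(u, v) \<in> parcs G" for u v
    using kr_arrow_same_color[of n "fst u" "fst v"] arc[OF that] not_chained color params assms(1)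
    by blast
  have path: "u \<in> pverts G \<and> v \<in> pverts G \<and> kr_above (fst u) (fst v)" if "(u, v) \<in> (parcs G)\<^sup>+" for u v
    using that
  proof induction
    case (base v)
    then show ?case using arc kr_arrow_imp_above color assms(1) by blast
  next
    case (step v w)
    then show ?case using arc kr_arrow_imp_above color assms(1) kr_above_trans by blast
  qed
  have "line (with_proj G)"
  proof (rule line_if_totally_ordered_without_shortcuts)
    show "pair_wf_digraph G"
      using arc by unfold_locales auto
    show "totally_ordered (with_proj G)"
      using assms(5) by (simp add: G_def)
    show "(u, u) \<notin> parcs G" for u
      using diff by blast
    show "(u, v) \<notin> parcs G" if w: "(u, w) \<in> (parcs G)\<^sup>+" "(w, v) \<in> parcs G" for u v w
    proof
      assume uv: "(u, v) \<in> parcs G"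
      note facts = path[OF w(1)] arc[OF w(2)] arc[OF uv]
      \<comment> \<open>Both colors differ from that of \<open>v\<close>, and at most two colors
        occur.\<close>
      have "fst (fst u) = fst (fst w)"
        using diff[OF w(2)] diff[OF uv] color[of u] color[of v] color[of w] facts by auto
      then show False
        using no_arrow_shortcut[of "fst u" "fst w" n "fst v"] facts not_chained color params assms(1)
        by blast
    qed
  qed
  moreover have "color u \<noteq> color v" if "adjacent (with_proj G) u v" for u v
    using that diff[of u v] diff[of v u] by (auto simp: adjacent_def color_def)
  ultimately show ?thesis
    unfolding G_def by blast
qed

end
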